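(* Let $k\ge 1$ be an integer and let $b$ be a positive integer with $\gcd(5,b)=1$. Then for all integers $n\ge 0$ and $r\in\{2,3\}$, $$p_{[1,4;-(5^k-3b)/b]}(5n+r)\equiv 0\pmod 5.$$
   Context: For a rational number $t$ and an integer $m>1$, the rational numbers $p_{[1,m;t]}(n)$, $n\ge 0$, are defined by the formal power series identity $\sum_{n\ge 0}p_{[1,m;t]}(n)q^n=\prod_{j\ge 1}\big((1-q^j)(1-q^{mj})\big)^t$, where each power is the binomial series with constant term $1$. For a prime $\ell$ not dividing the denominator of $t$, a congruence $p_{[1,m;t]}(N)\equiv 0\pmod{\ell^k}$ means that the numerator of $p_{[1,m;t]}(N)$, written as a reduced fraction, is divisible by $\ell^k$ (the denominator is then coprime to $\ell$). *)

theory Defs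
  imports "HOL-Analysis.Analysis" "HOL-Computational_Algebra.Formal_Power_Series"
begin

text \<open>
  \<open>fps_rat_power F t\<close> is $F^t$ for a series \<open>F\<close> with constant term 1, i.e. the binomial series
  $\sum_k \binom{t}{k} (F - 1)^k$. If the constant term of \<open>F\<close> is not 1, the value is meaningless.
\<close>

definition fps_rat_power :: "rat fps \<Rightarrow> rat \<Rightarrow> rat fps" where
  "fps_rat_power F t = fps_binomial t oo (F - 1)"

text \<open>The index is shifted: \<open>j\<close> starts at 0 here, so \<open>Suc j\<close> is the index of the factor.\<close>

definition p_factor :: "nat \<Rightarrow> rat \<Rightarrow> nat \<Rightarrow> rat fps" where
  "p_factor m t j = fps_rat_power ((1 - fps_X ^ Suc j) * (1 - fps_X ^ (m * Suc j))) t"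

definition p_series :: "nat \<Rightarrow> rat \<Rightarrow> rat fps" where
  "p_series m t = (\<Prod>j. p_factor m t j)"

definition p_coeff :: "nat \<Rightarrow> rat \<Rightarrow> nat \<Rightarrow> rat" where
  "p_coeff m t n = fps_nth (p_series m t) n"

text \<open>
  The infinite product converges in the topology of formal power series, so \<open>p_series\<close>
  is not an underspecified value.
\<close>

lemma p_factor_nth_0: "fps_nth (p_factor m t j) 0 = 1"
  by (simp add: p_factor_def fps_rat_power_def)

lemma p_factor_nth:
  assumes "m > 0" "0 < i" "i \<le> j"
  shows "fps_nth (p_factor m t j) i = 0"
proof -
  define G :: "rat fps" where "G = (1 - fps_X ^ Suc j) * (1 - fps_X ^ (m * Suc j)) - 1"
  have le: "Suc j \<le> m * Suc j"
    using mult_le_mono1[of 1 m "Suc j"] assms(1) by simp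
  have "Suc j + (m * Suc j - Suc j) = m * Suc j"
    using le by (rule le_add_diff_inverse)
  then have split: "(fps_X :: rat fps) ^ (m * Suc j) = fps_X ^ Suc j * fps_X ^ (m * Suc j - Suc j)"
    by (simp only: power_add[symmetric])
  have "(1 - X) * (1 - X * Y) - 1 = X * (X * Y - 1 - Y)" for X Y :: "rat fps"
    by (simp add: algebra_simps)
  then have "\<exists>H. G = fps_X ^ Suc j * H"
    unfolding G_def split by (intro exI)
  then obtain H where H: "G = fps_X ^ Suc j * H"
    by (elim exE)
  have "fps_nth (G ^ Suc k) i = 0" for k
  proof -
    have "G ^ Suc k = fps_X ^ Suc j * (H * G ^ k)"
      by (simp only: power_Suc H mult.assoc)
    moreover have "i < Suc j"
      using assms(3) by simp
    ultimately show ?thesis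
      by (simp only: fps_X_power_mult_nth if_True)
  qed
  moreover have "fps_nth (G ^ 0) i = 0"
    using assms(2) by simp
  ultimately have "fps_nth (G ^ k) i = 0" for k
    by (cases k) (simp_all only:)
  then show ?thesis
    by (simp only: p_factor_def fps_rat_power_def G_def[symmetric] fps_compose_nth
          mult_zero_right sum.neutral_const)
qed

lemma p_partial_prod_nth:
  assumes "m > 0" "i \<le> N" "N \<le> n"
  shows "fps_nth (\<Prod>j\<le>n. p_factor m t j) i = fps_nth (\<Prod>j\<le>N. p_factor m t j) i"
  using assms(3)
proof (induction n rule: dec_induct)
  case (step n)
  let ?P = "\<Prod>j\<le>n. p_factor m t j"
  have "fps_nth (?P * p_factor m t (Suc n)) i
      = (\<Sum>k=0..i. fps_nth ?P k * fps_nth (p_factor m t (Suc n)) (i - k))"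
    by (simp add: fps_mult_nth)
  also have "\<dots> = (\<Sum>k=0..i. if k = i then fps_nth ?P k else 0)"
    using assms step.hyps by (intro sum.cong) (auto simp: p_factor_nth_0 p_factor_nth)
  also have "\<dots> = fps_nth ?P i"
    by simp
  finally show ?case
    using step.IH by simp
qed simp

lemma p_series_has_prod:
  assumes "m > 0"
  shows "p_factor m t has_prod p_series m t"
proof -
  define L where "L = Abs_fps (\<lambda>i. fps_nth (\<Prod>j\<le>i. p_factor m t j) i)"
  have "(\<lambda>n. \<Prod>j\<le>n. p_factor m t j) \<longlonglongrightarrow> L"
  proof (rule tendsto_fpsI)
    fix i
    show "\<forall>\<^sub>F n in sequentially. fps_nth (\<Prod>j\<le>n. p_factor m t j) i = fps_nth L i"
      using eventually_ge_at_top[of i]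
    proof eventually_elim
      case (elim n)
      show ?case
        unfolding L_def fps_nth_Abs_fps by (rule p_partial_prod_nth[OF assms order_refl elim])
    qed
  qed
  moreover have "fps_nth L 0 = 1"
    by (simp add: L_def p_factor_nth_0)
  then have "L \<noteq> 0"
    by auto
  ultimately have "p_factor m t has_prod L"
    by (simp add: has_prod_def raw_has_prod_def)
  then show ?thesis
    unfolding p_series_def using has_prod_unique by metis
qed

end

theory Submission
  imports Defs "HOL-Number_Theory.Cong" "HOL-Library.Nat_Bijection"
    "HOL-Computational_Algebra.Formal_Laurent_Series"
begin

text \<open>
  Write $t = 3 + 5 s$ with $s = -5^{k-1}/b$, so that the series is $(E(q) E(q^4))^3 G^5$, where
  $E(q) = \prod_j (1 - q^j)$ and $G$ has coefficients without 5 in the denominator. Modulo 5, only exponents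
  divisible by 5 occur in $G^5$. By Jacobi's identity $E(q)^3 = \sum_k (-1)^k (2k+1) q^{k(k+1)/2}$, a
  coefficient of $E^3$ that is not divisible by 5 sits at an exponent $u$ congruent to 0 or 1, and then
  $u + 4 v$ is never congruent to 2 or 3. Jacobi's identity is obtained from its finite form
  $\prod_{j \le n} (1 - q^j)^2 = \sum_k (-1)^k (2k+1) q^{k(k+1)/2} {2n+1 \brack n-k}$,
  which follows by induction on $n$.
\<close>

subsection \<open>Jacobi's identity\<close>

text \<open>The q-Pochhammer symbol (q; q)_n, with q = \<open>fps_X\<close>.\<close>

definition euler_prod :: "nat \<Rightarrow> 'a::field fps" where
  "euler_prod n = (\<Prod>i<n. 1 - fps_X ^ Suc i)"

lemma euler_prod_0 [simp]: "euler_prod 0 = 1"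
  by (simp add: euler_prod_def)

lemma euler_prod_Suc: "euler_prod (Suc n) = euler_prod n * (1 - fps_X ^ Suc n)"
  by (simp add: euler_prod_def)

lemma euler_prod_nth_0 [simp]: "fps_nth (euler_prod n) 0 = 1"
  by (induction n) (simp_all add: euler_prod_Suc)

lemma euler_prod_inverse: "euler_prod n * inverse (euler_prod n) = 1"
  by (metis euler_prod_nth_0 inverse_mult_eq_1' zero_neq_one)

text \<open>Serves to bring inverses with different indices to the largest one, so that identities
  between Gaussian coefficients become polynomial identities.\<close>

lemma inverse_euler_prod:
  "inverse (euler_prod n) = inverse (euler_prod (Suc n)) * (1 - fps_X ^ Suc n)"
proof -
  have "inverse (euler_prod (Suc n)) * (1 - fps_X ^ Suc n)
      = (euler_prod n * inverse (euler_prod n)) * (inverse (euler_prod (Suc n)) * (1 - fps_X ^ Suc n))"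
    by (simp only: euler_prod_inverse mult_1)
  also have "\<dots> = inverse (euler_prod n) * (euler_prod (Suc n) * inverse (euler_prod (Suc n)))"
    unfolding euler_prod_Suc by (simp only: mult_ac)
  also have "\<dots> = inverse (euler_prod n)"
    by (simp only: euler_prod_inverse mult_1_right)
  finally show ?thesis ..
qed

text \<open>The Gaussian binomial coefficient with upper entry \<open>2 n + 1\<close> and lower entry \<open>n - k\<close>.\<close>

definition odd_gauss :: "nat \<Rightarrow> nat \<Rightarrow> 'a::field fps" where
  "odd_gauss n k = (if k \<le> n then
     euler_prod (2 * n + 1) * inverse (euler_prod (n - k)) * inverse (euler_prod (n + k + 1)) else 0)"

lemma odd_gauss_diag: "odd_gauss n n = 1"
  by (simp add: odd_gauss_def euler_prod_inverse mult_2)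

text \<open>The factor \<open>1 - fps_X ^ (n - k)\<close> vanishes at \<open>k = n\<close>, so one
  formula also covers the value 0 outside the range.\<close>

lemma odd_gauss_Suc_right:
  assumes "k \<le> n"
  shows "(odd_gauss n (Suc k) :: 'a::field fps) = euler_prod (2 * n + 1) * inverse (euler_prod (n - k))
           * (1 - fps_X ^ (n - k)) * inverse (euler_prod (n + k + 2))"
proof (cases "k = n")
  case False
  then have "n - k = Suc (n - Suc k)"
    using assms by simp
  then show ?thesis
    using False assms inverse_euler_prod[of "n - Suc k", where ?'a = 'a]
    by (simp add: odd_gauss_def mult_ac del: power_Suc)
qed (simp add: odd_gauss_def)

text \<open>
  For \<open>k \<ge> 1\<close> the product multiplying \<open>X^(n + 1 - k)\<close> is \<open>odd_gauss n (k - 1)\<close>; for \<open>k = 0\<close> it is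
  \<open>odd_gauss n 0\<close>, because the Gaussian binomial coefficient is symmetric.
\<close>

lemma odd_gauss_rec_aux:
  assumes "k \<le> n"
  shows "(odd_gauss (Suc n) k :: 'a::field fps) =
    fps_X ^ (Suc n - k) * (euler_prod (2 * n + 1) * inverse (euler_prod (Suc n - k)) * inverse (euler_prod (n + k)))
    + (1 + fps_X ^ (2 * n + 2)) * odd_gauss n k + fps_X ^ (n + k + 2) * odd_gauss n (Suc k)"
proof -
  define x :: "'a fps" where "x = fps_X"
  define a b where "a = x ^ (n - k)" and "b = x ^ (n + k + 1)"
  define Q where "Q = (euler_prod (2 * n + 1) :: 'a fps)"
  define U where "U = inverse (euler_prod (Suc n - k) :: 'a fps)"
  define V where "V = inverse (euler_prod (n + k + 2) :: 'a fps)"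
  have "a * b = x ^ (n - k + (n + k + 1))"
    unfolding a_def b_def by (rule power_add[symmetric])
  also have "n - k + (n + k + 1) = 2 * n + 1"
    using assms by simp
  finally have ab: "a * b = x ^ (2 * n + 1)" .
  \<comment> \<open>All powers become monomials in \<open>a\<close>, \<open>b\<close>,
    \<open>x\<close>; what remains is a polynomial identity in these and \<open>Q\<close>,
    \<open>U\<close>, \<open>V\<close>.\<close>
  have pw: "x ^ (Suc n - k) = a * x" "x ^ (n + k + 2) = b * x" "x ^ (2 * n + 2) = a * b * x"
      "x ^ (2 * n + 3) = a * b * x * x" "x ^ (n + k + 1) = b" "x ^ (n - k) = a"
    unfolding ab unfolding a_def b_def
    using assms by (simp_all add: Suc_diff_le eval_nat_numeral mult_ac)
  have R1: "inverse (euler_prod (n - k)) = U * (1 - a * x)"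
    using inverse_euler_prod[of "n - k", where ?'a = 'a] assms pw
    by (simp add: U_def Suc_diff_le x_def del: power_Suc)
  have R2: "inverse (euler_prod (n + k + 1)) = V * (1 - b * x)"
    using inverse_euler_prod[of "n + k + 1", where ?'a = 'a] pw
    by (simp add: V_def x_def del: power_Suc)
  have R3: "inverse (euler_prod (n + k)) = V * (1 - b * x) * (1 - b)"
    using inverse_euler_prod[of "n + k", where ?'a = 'a] pw R2
    by (simp add: x_def del: power_Suc)
  have "euler_prod (2 * Suc n + 1) = Q * (1 - x ^ (2 * n + 2)) * (1 - x ^ (2 * n + 3))"
    by (simp add: euler_prod_Suc Q_def x_def eval_nat_numeral)
  then have Q2: "euler_prod (2 * Suc n + 1) = Q * (1 - a * b * x) * (1 - a * b * x * x)"
    by (simp only: pw)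
  have "odd_gauss (Suc n) k = euler_prod (2 * Suc n + 1) * U * V"
    using assms by (simp add: odd_gauss_def U_def V_def)
  moreover have "odd_gauss n k = Q * (U * (1 - a * x)) * (V * (1 - b * x))"
    using assms R1 R2 by (simp add: odd_gauss_def Q_def)
  moreover have "odd_gauss n (Suc k) = Q * (U * (1 - a * x)) * (1 - a) * V"
    using assms R1 by (simp add: odd_gauss_Suc_right Q_def V_def flip: x_def pw)
  ultimately show ?thesis
    unfolding x_def[symmetric] pw R3 Q2 Q_def[symmetric] U_def[symmetric]
    by (simp only:) (simp add: algebra_simps)
qed

lemma odd_gauss_rec_0:
  "odd_gauss (Suc n) 0 = fps_X ^ Suc n * odd_gauss n 0
     + (1 + fps_X ^ (2 * n + 2)) * odd_gauss n 0 + fps_X ^ (n + 2) * odd_gauss n 1"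
  using odd_gauss_rec_aux[of 0 n] by (simp add: odd_gauss_def mult_ac)

text \<open>This amounts to two applications of the q-Pascal rule, once in each of its forms. At
  \<open>k = n\<close> both sides are 1.\<close>

lemma odd_gauss_rec_Suc:
  assumes "k \<le> n"
  shows "odd_gauss (Suc n) (Suc k) = fps_X ^ (n - k) * odd_gauss n k
     + (1 + fps_X ^ (2 * n + 2)) * odd_gauss n (Suc k) + fps_X ^ (n + k + 3) * odd_gauss n (Suc (Suc k))"
proof (cases "k = n")
  case True
  then show ?thesis by (simp add: odd_gauss_diag) (simp add: odd_gauss_def)
next
  case False
  then show ?thesis
    using assms odd_gauss_rec_aux[of "Suc k" n] by (simp add: odd_gauss_def eval_nat_numeral)
qed

definition jacobi_coeff :: "nat \<Rightarrow> int" where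
  "jacobi_coeff k = (-1) ^ k * (2 * int k + 1)"

text \<open>
  Applying the recursion of \<open>odd_gauss\<close> to the sum for \<open>n + 1\<close>, the coefficient of \<open>odd_gauss n k\<close> becomes
  \<open>X^triangle k * (c k * (1 + y^2) + (c (k + 1) + c (k - 1)) * y)\<close> with \<open>y = X^(n + 1)\<close>, and
  \<open>c (k + 1) + c (k - 1) = - 2 * c k\<close> turns this into \<open>(1 - y)^2 * c k * X^triangle k\<close>.
  In the proof, \<open>d k\<close> is \<open>c (k - 1)\<close>, extended to \<open>k = 0\<close>.
\<close>

lemma finite_jacobi:
  "(\<Sum>k\<le>n. of_int (jacobi_coeff k) * fps_X ^ triangle k * odd_gauss n k)
     = (euler_prod n :: 'a::field fps)\<^sup>2"
proof (induction n)
  case 0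
  show ?case by (simp add: jacobi_coeff_def odd_gauss_diag)
next
  case (Suc n)
  define c :: "nat \<Rightarrow> 'a fps" where "c k = of_int (jacobi_coeff k)" for k
  define d :: "nat \<Rightarrow> 'a fps" where "d k = (-1) ^ Suc k * (2 * of_nat k - 1)" for k
  define x :: "'a fps" where "x = fps_X"
  define B :: "nat \<Rightarrow> 'a fps" where "B = odd_gauss n"
  have B0: "B k = 0" if "k > n" for k
    using that by (simp add: B_def odd_gauss_def)
  have d_Suc: "d (Suc k) = c k" for k
    by (simp add: c_def d_def jacobi_coeff_def)
  have cd: "c (Suc k) + d k = - 2 * c k" for k
    by (simp add: c_def d_def jacobi_coeff_def algebra_simps)
  define y where "y = x ^ Suc n"
  define e where "e k = c k * x ^ triangle k * B k" for k
  define f where "f k = c (Suc k) * x ^ triangle k * y * B k" for k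
  define g where "g k = d k * x ^ triangle k * y * B k" for k
  have y2: "x ^ (2 * n + 2) = y\<^sup>2"
    by (simp add: y_def power2_eq_square power_add[symmetric] mult_2 del: power_Suc)
  have step: "c (Suc k) * x ^ triangle (Suc k) * odd_gauss (Suc n) (Suc k)
      = f k + (1 + y\<^sup>2) * e (Suc k) + g (Suc (Suc k))" if k: "k \<le> n" for k
  proof -
    \<comment> \<open>Since \<open>triangle (Suc k) = triangle k + Suc k\<close>, moving to either
      neighbouring index leaves the same extra factor \<open>y\<close>.\<close>
    have e1: "x ^ triangle (Suc k) * x ^ (n - k) = x ^ triangle k * y"
      using k by (simp add: y_def power_add[symmetric] del: power_Suc)
    have e2: "x ^ triangle (Suc k) * x ^ (n + k + 3) = x ^ triangle (Suc (Suc k)) * y"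
      by (simp add: y_def power_add[symmetric] eval_nat_numeral add_ac del: power_Suc)
    have "c (Suc k) * x ^ triangle (Suc k) * odd_gauss (Suc n) (Suc k)
       = c (Suc k) * (x ^ triangle (Suc k) * x ^ (n - k)) * B k
          + (1 + y\<^sup>2) * e (Suc k)
          + c (Suc k) * (x ^ triangle (Suc k) * x ^ (n + k + 3)) * B (Suc (Suc k))"
      unfolding odd_gauss_rec_Suc[OF k] B_def e_def y2[symmetric] unfolding x_def
      by (simp only: distrib_left mult.assoc mult.left_commute)
    then show ?thesis
      unfolding e1 e2 f_def g_def d_Suc by (simp only: mult.assoc)
  qed
  have "(\<Sum>k\<le>Suc n. c k * x ^ triangle k * odd_gauss (Suc n) k)
      = odd_gauss (Suc n) 0 + (\<Sum>k\<le>n. c (Suc k) * x ^ triangle (Suc k) * odd_gauss (Suc n) (Suc k))"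
    by (subst sum.atMost_Suc_shift) (simp add: c_def jacobi_coeff_def)
  \<comment> \<open>Here \<open>d 0 = 1\<close>, so the mirrored term of the recursion at 0 is
    exactly \<open>g 0\<close>.\<close>
  also have "odd_gauss (Suc n) 0 = g 0 + (1 + y\<^sup>2) * e 0 + g 1"
    unfolding y2[symmetric]
    by (simp add: odd_gauss_rec_0 e_def g_def y_def B_def x_def c_def d_def jacobi_coeff_def triangle_def)
  also have "(\<Sum>k\<le>n. c (Suc k) * x ^ triangle (Suc k) * odd_gauss (Suc n) (Suc k))
      = (\<Sum>k\<le>n. f k + (1 + y\<^sup>2) * e (Suc k) + g (Suc (Suc k)))"
    using step by (intro sum.cong) auto
  also have "g 0 + (1 + y\<^sup>2) * e 0 + g 1 + \<dots>
      = sum f {..n} + (1 + y\<^sup>2) * sum e {..Suc n} + sum g {..Suc (Suc n)}"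
    unfolding sum.atMost_Suc_shift[of _ "Suc n"] sum.atMost_Suc_shift[of _ n]
    by (simp only: sum.distrib sum_distrib_left[symmetric] distrib_left One_nat_def add_ac)
  also have "\<dots> = sum f {..n} + (1 + y\<^sup>2) * sum e {..n} + sum g {..n}"
    by (simp add: B0 e_def g_def)
  also have "\<dots> = (\<Sum>k\<le>n. f k + (1 + y\<^sup>2) * e k + g k)"
    by (simp only: sum.distrib sum_distrib_left[symmetric])
  also have "\<dots> = (\<Sum>k\<le>n. (1 - y)\<^sup>2 * e k)"
  proof (intro sum.cong refl)
    fix k
    have "f k + (1 + y\<^sup>2) * e k + g k = (c (Suc k) + d k) * (x ^ triangle k * B k) * y + (1 + y\<^sup>2) * e k"
      by (simp only: f_def g_def distrib_left distrib_right mult_ac add_ac)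
    also have "\<dots> = - 2 * e k * y + (1 + y\<^sup>2) * e k"
      unfolding cd e_def by (simp only: mult.assoc)
    also have "\<dots> = (1 - y)\<^sup>2 * e k"
      by algebra
    finally show "f k + (1 + y\<^sup>2) * e k + g k = (1 - y)\<^sup>2 * e k" .
  qed
  also have "\<dots> = (1 - y)\<^sup>2 * (euler_prod n)\<^sup>2"
    using Suc.IH by (simp add: sum_distrib_left[symmetric] e_def B_def c_def x_def)
  also have "\<dots> = (euler_prod (Suc n))\<^sup>2"
    by (simp add: euler_prod_Suc x_def y_def power_mult_distrib)
  finally show ?case
    by (simp add: c_def x_def)
qed

section \<open>From the finite identity to Jacobi's series, modulo
  \<open>fps_X ^ Suc M\<close>\<close>

lemma fps_nth_eq_of_dvd_diff:
  assumes "fps_X ^ Suc M dvd f - g" "i \<le> M"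
  shows "fps_nth f i = fps_nth (g :: 'a::comm_ring_1 fps) i"
proof -
  obtain h where "f - g = fps_X ^ Suc M * h"
    using assms(1) by (rule dvdE)
  then have "f = g + fps_X ^ Suc M * h"
    by (simp only: diff_eq_eq add.commute)
  then show ?thesis
    using assms(2) by (simp add: fps_X_power_mult_nth del: power_Suc)
qed

lemma euler_prod_stable:
  assumes "M \<le> n"
  shows "fps_X ^ Suc M dvd euler_prod n - (euler_prod M :: 'a::field fps)"
  using assms
proof (induction n rule: dec_induct)
  case (step n)
  have "euler_prod (Suc n) - (euler_prod M :: 'a fps) = (euler_prod n - euler_prod M) - euler_prod n * fps_X ^ Suc n"
    by (simp add: euler_prod_Suc algebra_simps)
  moreover have "fps_X ^ Suc M dvd (fps_X ^ Suc n :: 'a fps)"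
    using step by (intro le_imp_power_dvd) simp
  ultimately show ?case
    using step.IH by (simp only: dvd_diff[OF _ dvd_mult])
qed simp

text \<open>All indices of \<open>euler_prod\<close> that occur are at least \<open>M\<close> (for
  \<open>n - k\<close> this uses \<open>2 * M <= n\<close>), so modulo \<open>fps_X ^ Suc M\<close>
  all these products agree and the quotient is 1.\<close>

lemma euler_prod_odd_gauss:
  assumes "k \<le> M" "2 * M \<le> n"
  shows "fps_X ^ Suc M dvd euler_prod n * odd_gauss n k - (1 :: 'a::field fps)"
proof -
  define Q where "Q = (euler_prod :: nat \<Rightarrow> 'a fps)"
  define E where "E = Q M"
  have st: "fps_X ^ Suc M dvd Q m - E" if "M \<le> m" for m
    using euler_prod_stable[OF that] by (simp add: Q_def E_def)
  \<comment> \<open>Each \<open>Q\<close> is exchanged for \<open>E\<close> in turn; the two copies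
    of \<open>E * E\<close> cancel.\<close>
  have "fps_X ^ Suc M dvd (Q n - E) * Q (2 * n + 1) + E * (Q (2 * n + 1) - E)
      - (Q (n - k) - E) * Q (n + k + 1) - E * (Q (n + k + 1) - E)"
    using assms by (intro dvd_diff dvd_add dvd_mult dvd_mult2 st) simp_all
  also have "\<dots> = Q n * Q (2 * n + 1) - Q (n - k) * Q (n + k + 1)"
    by algebra
  finally have "fps_X ^ Suc M dvd (Q n * Q (2 * n + 1) - Q (n - k) * Q (n + k + 1))
      * (inverse (Q (n - k)) * inverse (Q (n + k + 1)))"
    by (rule dvd_mult2)
  also have "\<dots> = Q n * odd_gauss n k - (Q (n - k) * inverse (Q (n - k))) * (Q (n + k + 1) * inverse (Q (n + k + 1)))"
    using assms by (simp add: odd_gauss_def Q_def algebra_simps)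
  also have "\<dots> = Q n * odd_gauss n k - 1"
    by (simp only: Q_def euler_prod_inverse mult_1)
  finally show ?thesis
    by (simp only: Q_def)
qed

lemma triangle_ge: "k \<le> triangle k"
  by (induction k) simp_all

text \<open>Multiply \<open>finite_jacobi\<close> by \<open>euler_prod n\<close>: the square becomes
  a cube and each \<open>euler_prod n * odd_gauss n k\<close> with \<open>k <= M\<close> becomes 1
  up to degree \<open>M\<close>. Terms with \<open>k > M\<close> start beyond degree
  \<open>M\<close>, as \<open>triangle k >= k\<close>.\<close>

lemma euler_prod_cubed_nth:
  assumes "i \<le> M" "2 * M \<le> n"
  shows "fps_nth (euler_prod n ^ 3 :: 'a::field fps) i
       = (\<Sum>k\<le>M. if triangle k = i then of_int (jacobi_coeff k) else 0)"
proof -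
  define c :: "nat \<Rightarrow> 'a fps" where "c k = of_int (jacobi_coeff k)" for k
  have "euler_prod n ^ 3 - (\<Sum>k\<le>M. c k * fps_X ^ triangle k)
      = (\<Sum>k\<le>n. c k * fps_X ^ triangle k * (euler_prod n * odd_gauss n k))
        - (\<Sum>k\<le>M. c k * fps_X ^ triangle k)"
    using finite_jacobi[of n, where ?'a = 'a]
    by (simp add: power3_eq_cube power2_eq_square c_def sum_distrib_left[symmetric] mult.left_commute mult.assoc)
  also have "(\<Sum>k\<le>n. c k * fps_X ^ triangle k * (euler_prod n * odd_gauss n k))
      = (\<Sum>k\<le>M. c k * fps_X ^ triangle k * (euler_prod n * odd_gauss n k))
        + (\<Sum>k=Suc M..n. c k * fps_X ^ triangle k * (euler_prod n * odd_gauss n k))"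
    using assms(2) by (subst sum.union_disjoint[symmetric]) (auto intro!: sum.cong)
  also have "\<dots> - (\<Sum>k\<le>M. c k * fps_X ^ triangle k)
      = (\<Sum>k\<le>M. c k * fps_X ^ triangle k * (euler_prod n * odd_gauss n k - 1))
        + (\<Sum>k=Suc M..n. c k * fps_X ^ triangle k * (euler_prod n * odd_gauss n k))"
    by (simp add: right_diff_distrib sum_subtractf)
  finally have eq: "euler_prod n ^ 3 - (\<Sum>k\<le>M. c k * fps_X ^ triangle k) = \<dots>" .
  have "fps_X ^ Suc M dvd (fps_X ^ triangle k :: 'a fps)" if "Suc M \<le> k" for k
    using that triangle_ge[of k] by (intro le_imp_power_dvd) simp
  then have "fps_X ^ Suc M dvd c k * fps_X ^ triangle k * (euler_prod n * odd_gauss n k)"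
    if "k \<in> {Suc M..n}" for k
    using that by (intro dvd_mult2[OF dvd_mult]) simp
  moreover have "fps_X ^ Suc M dvd c k * fps_X ^ triangle k * (euler_prod n * odd_gauss n k - 1)"
    if "k \<in> {..M}" for k
    using that assms(2) by (intro dvd_mult euler_prod_odd_gauss) simp_all
  ultimately have "fps_X ^ Suc M dvd euler_prod n ^ 3 - (\<Sum>k\<le>M. c k * fps_X ^ triangle k)"
    unfolding eq by (intro dvd_add dvd_sum)
  then have "fps_nth (euler_prod n ^ 3) i = fps_nth (\<Sum>k\<le>M. c k * fps_X ^ triangle k) i"
    using assms(1) by (rule fps_nth_eq_of_dvd_diff)
  also have "\<dots> = (\<Sum>k\<le>M. if triangle k = i then of_int (jacobi_coeff k) else 0)"
    unfolding fps_sum_nth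
  proof (intro sum.cong refl)
    fix k
    have "fps_nth (c k * fps_X ^ triangle k) i = of_int (jacobi_coeff k) * fps_nth (fps_X ^ triangle k) i"
      unfolding c_def fps_of_int[symmetric] by (rule fps_mult_left_const_nth)
    then show "fps_nth (c k * fps_X ^ triangle k) i = (if triangle k = i then of_int (jacobi_coeff k) else 0)"
      by (simp only: fps_X_power_nth) simp
  qed
  finally show ?thesis .
qed

subsection \<open>Rational numbers integral at a prime\<close>

text \<open>The localization of the integers at the prime ideal (p). The case \<open>c = 0\<close>
  is excluded because \<open>p\<close> divides 0.\<close>

definition zloc :: "nat \<Rightarrow> rat set" where
  "zloc p = {of_int a / of_int c |a c. \<not> int p dvd c}"

lemma zlocI: "\<not> int p dvd c \<Longrightarrow> of_int a / of_int c \<in> zloc p"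
  by (auto simp: zloc_def)

lemma zlocE:
  assumes "x \<in> zloc p"
  obtains a c where "x = of_int a / of_int c" "\<not> int p dvd c" "c \<noteq> 0"
proof -
  obtain a c where "x = of_int a / of_int c" "\<not> int p dvd c"
    using assms by (auto simp: zloc_def)
  then show ?thesis
    by (intro that[of a c]) auto
qed

definition zloc_fps :: "nat \<Rightarrow> rat fps set" where
  "zloc_fps p = {f. \<forall>n. fps_nth f n \<in> zloc p}"

lemma zloc_fpsD: "f \<in> zloc_fps p \<Longrightarrow> fps_nth f n \<in> zloc p"
  by (simp add: zloc_fps_def)

context
  fixes p :: nat
  assumes prime: "prime p"
begin

lemma zloc_of_int: "of_int a \<in> zloc p"
  using zlocI[of p 1 a] prime by (simp add: prime_nat_iff)

lemma zloc_0: "0 \<in> zloc p" and zloc_1: "1 \<in> zloc p"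
  using zloc_of_int[of 0] zloc_of_int[of 1] by simp_all

lemma zloc_add:
  assumes "x \<in> zloc p" "y \<in> zloc p"
  shows "x + y \<in> zloc p"
proof -
  obtain a c where x: "x = of_int a / of_int c" "\<not> int p dvd c" "c \<noteq> 0"
    using assms(1) by (rule zlocE)
  obtain b d where y: "y = of_int b / of_int d" "\<not> int p dvd d" "d \<noteq> 0"
    using assms(2) by (rule zlocE)
  have "x + y = of_int (a * d + b * c) / of_int (c * d)"
    using x y by (simp add: field_simps)
  also have "\<dots> \<in> zloc p"
    using x y prime by (intro zlocI) (simp add: prime_dvd_mult_iff)
  finally show ?thesis .
qed

lemma zloc_mult:
  assumes "x \<in> zloc p" "y \<in> zloc p"
  shows "x * y \<in> zloc p"
proof -
  obtain a c where x: "x = of_int a / of_int c" "\<not> int p dvd c"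
    using assms(1) by (rule zlocE)
  obtain b d where y: "y = of_int b / of_int d" "\<not> int p dvd d"
    using assms(2) by (rule zlocE)
  have "x * y = of_int (a * b) / of_int (c * d)"
    using x y by simp
  also have "\<dots> \<in> zloc p"
    using x y prime by (intro zlocI) (simp add: prime_dvd_mult_iff)
  finally show ?thesis .
qed

lemma zloc_sum: "(\<And>i. i \<in> A \<Longrightarrow> f i \<in> zloc p) \<Longrightarrow> sum f A \<in> zloc p"
  by (induction A rule: infinite_finite_induct) (simp_all add: zloc_0 zloc_add)

lemma zloc_diff:
  assumes "x \<in> zloc p" "y \<in> zloc p"
  shows "x - y \<in> zloc p"
  using zloc_add[OF assms(1) zloc_mult[OF zloc_of_int[of "-1"] assms(2)]] by simp

text \<open>Divisibility by \<open>p\<close> is handled as membership of \<open>x / p\<close> in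
  \<open>zloc p\<close>; this translates it back to the reduced numerator. Clearing denominators
  gives \<open>u * c = p * (a * w)\<close> with \<open>c\<close> prime to \<open>p\<close>.\<close>

lemma dvd_numerator_if_zloc:
  assumes "x / of_nat p \<in> zloc p"
  shows "int p dvd fst (quotient_of x)"
proof -
  obtain a c where ac: "x / of_nat p = of_int a / of_int c" "\<not> int p dvd c" "c \<noteq> 0"
    using assms by (rule zlocE)
  obtain u w where uw: "quotient_of x = (u, w)"
    by fastforce
  then have x: "x = of_int u / of_int w" "w > 0"
    by (simp_all add: quotient_of_div quotient_of_denom_pos)
  have "p > 0"
    using prime by (rule prime_gt_0_nat)
  then have "of_int (u * c) = (of_int (int p * (a * w)) :: rat)"
    using ac x by (simp add: field_simps)
  then have "u * c = int p * (a * w)"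
    by (simp only: of_int_eq_iff)
  then have "int p dvd u * c"
    by simp
  then show ?thesis
    using ac prime uw by (simp add: prime_dvd_mult_iff)
qed

text \<open>
  With \<open>v\<close> the exponent of \<open>p\<close> in \<open>fact j\<close>, the fraction \<open>s\<close> is congruent modulo \<open>p^v\<close> to a natural number \<open>N\<close>,
  so the falling factorial of \<open>s\<close> is, modulo \<open>p^v\<close>, that of \<open>N\<close>, which is a multiple of \<open>fact j\<close>.
\<close>

lemma zloc_gchoose:
  assumes "s \<in> zloc p"
  shows "s gchoose j \<in> zloc p"
proof -
  obtain a b where s: "s = of_int a / of_int b" "\<not> int p dvd b" "b \<noteq> 0"
    using assms by (rule zlocE)
  have pp: "prime (int p)"
    using prime by simp
  obtain v u where v: "(fact j :: int) = int p ^ v * u" "\<not> int p dvd u"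
    using multiplicity_decompose'[of "fact j :: int" "int p"] pp
    by (metis fact_nonzero not_prime_unit)
  have "coprime b (int p ^ v)"
    using prime_imp_coprime[OF pp s(2)] by (simp add: coprime_commute)
  then obtain z where z: "[b * z = 1] (mod int p ^ v)"
    using cong_solve_coprime_int by blast
  \<comment> \<open>\<open>z\<close> inverts \<open>b\<close> modulo \<open>p^v\<close>, so
    \<open>N\<close> represents the fraction \<open>a / b\<close> there.\<close>
  define N where "N = nat ((a * z) mod int p ^ v)"
  have "int N = (a * z) mod int p ^ v"
    using prime_gt_0_nat[OF prime] by (simp add: N_def)
  then have "[b * int N = b * (a * z)] (mod int p ^ v)"
    by (simp add: cong_def mod_mult_right_eq)
  also have "b * (a * z) = a * (b * z)"
    by simp
  also have "[a * (b * z) = a * 1] (mod int p ^ v)"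
    using z by (rule cong_scalar_left)
  finally have N: "[a = b * int N] (mod int p ^ v)"
    by (simp add: cong_sym_eq)
  have "of_int (\<Prod>i<j. int N - int i) = (of_nat N gchoose j) * (fact j :: rat)"
    by (simp add: gbinomial_prod_rev lessThan_atLeast0)
  also have "\<dots> = of_int (int (N choose j) * fact j)"
    by (simp add: binomial_gbinomial)
  finally have fact: "(\<Prod>i<j. int N - int i) = int (N choose j) * fact j"
    by (simp only: of_int_eq_iff)
  have "[(\<Prod>i<j. a - b * int i) = (\<Prod>i<j. b * int N - b * int i)] (mod int p ^ v)"
    by (intro cong_prod cong_diff N cong_refl)
  also have "(\<Prod>i<j. b * int N - b * int i) = b ^ j * (\<Prod>i<j. int N - int i)"
    by (simp add: right_diff_distrib[symmetric] prod.distrib)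
  also have "\<dots> = int p ^ v * (b ^ j * int (N choose j) * u)"
    by (simp add: fact v)
  finally have "int p ^ v dvd (\<Prod>i<j. a - b * int i)"
    by (metis cong_dvd_iff dvd_triv_left)
  then obtain w where w: "(\<Prod>i<j. a - b * int i) = int p ^ v * w"
    by (rule dvdE)
  have "(\<Prod>i<j. s - of_nat i) = (\<Prod>i<j. of_int (a - b * int i) / of_int b)"
    using s by (intro prod.cong) (simp_all add: field_simps)
  also have "\<dots> = of_int (int p ^ v * w) / of_int b ^ j"
    by (simp only: prod_dividef of_int_prod[symmetric] w prod_constant card_lessThan of_int_power)
  finally have "s gchoose j = of_int (int p ^ v * w) / of_int b ^ j / of_int (fact j)"
    by (simp add: gbinomial_prod_rev lessThan_atLeast0)
  \<comment> \<open>The factor \<open>p^v\<close> cancels the whole \<open>p\<close>-part of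
    \<open>fact j\<close>.\<close>
  also have "\<dots> = of_int w / of_int (b ^ j * u)"
    using prime_gt_0_nat[OF prime] by (simp add: v field_simps)
  also have "\<dots> \<in> zloc p"
    using s(2) v(2) pp by (intro zlocI) (auto simp: prime_dvd_mult_iff dest: prime_dvd_power[OF pp])
  finally show ?thesis .
qed

section \<open>Power series with \<open>p\<close>-integral coefficients\<close>

lemma zloc_fps_mult: "f \<in> zloc_fps p \<Longrightarrow> g \<in> zloc_fps p \<Longrightarrow> f * g \<in> zloc_fps p"
  by (simp add: zloc_fps_def fps_mult_nth zloc_sum zloc_mult)

lemma zloc_fps_1: "1 \<in> zloc_fps p"
  by (simp add: zloc_fps_def zloc_0 zloc_1)

lemma zloc_fps_diff: "f \<in> zloc_fps p \<Longrightarrow> g \<in> zloc_fps p \<Longrightarrow> f - g \<in> zloc_fps p"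
  by (simp add: zloc_fps_def zloc_diff)

lemma zloc_fps_X_power: "fps_X ^ m \<in> zloc_fps p"
  by (simp add: zloc_fps_def fps_X_power_nth zloc_0 zloc_1)

lemma zloc_fps_power: "f \<in> zloc_fps p \<Longrightarrow> f ^ m \<in> zloc_fps p"
  by (induction m) (simp_all add: zloc_fps_1 zloc_fps_mult)

lemma zloc_fps_prod: "(\<And>i. i \<in> A \<Longrightarrow> f i \<in> zloc_fps p) \<Longrightarrow> prod f A \<in> zloc_fps p"
  by (induction A rule: infinite_finite_induct) (simp_all add: zloc_fps_1 zloc_fps_mult)

lemma zloc_fps_rat_power:
  assumes "F \<in> zloc_fps p" "s \<in> zloc p"
  shows "fps_rat_power F s \<in> zloc_fps p"
  using assms
  by (auto simp: zloc_fps_def[of p] fps_rat_power_def fps_compose_nth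
      intro!: zloc_sum zloc_mult zloc_gchoose zloc_fpsD zloc_fps_power zloc_fps_diff zloc_fps_1)

text \<open>Compare coefficients in \<open>(f^p)' = p * f' * f^(p - 1)\<close>.\<close>

lemma zloc_fps_power_prime_nth:
  assumes "f \<in> zloc_fps p" "\<not> p dvd n"
  shows "fps_nth (f ^ p) n / of_nat p \<in> zloc p"
proof -
  obtain m where m: "n = Suc m"
    using assms(2) by (cases n) auto
  define g where "g = fps_deriv f * f ^ (p - 1)"
  have "fps_deriv f \<in> zloc_fps p"
    using assms(1) zloc_of_int[of "int _"] by (simp add: zloc_fps_def zloc_mult zloc_add zloc_1)
  then have g: "fps_nth g m \<in> zloc p"
    unfolding g_def using assms(1) by (intro zloc_fpsD zloc_fps_mult zloc_fps_power)
  have "fps_deriv (f ^ p) = fps_const (of_nat p) * g"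
    by (simp add: fps_deriv_power g_def mult_ac)
  then have "of_nat n * fps_nth (f ^ p) n = of_nat p * fps_nth g m"
    using fps_deriv_nth[of "f ^ p" m] m by simp
  then have "fps_nth (f ^ p) n / of_nat p = fps_nth g m * (of_int 1 / of_int (int n))"
    using m prime_gt_0_nat[OF prime] by (simp add: field_simps)
  also have "\<dots> \<in> zloc p"
    using assms(2) by (intro zloc_mult g zlocI) simp
  finally show ?thesis .
qed

end

subsection \<open>The congruence\<close>

text \<open>The exponent laws of the binomial series survive substitution of \<open>F - 1\<close>,
  because its constant term is 0; a natural exponent gives \<open>(1 + fps_X) ^ m\<close>, which
  turns into \<open>F ^ m\<close>.\<close>

lemma fps_rat_power_split:
  assumes "fps_nth F 0 = 1"
  shows "fps_rat_power F (of_nat m + of_nat l * s) = F ^ m * fps_rat_power F s ^ l"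
proof -
  have 0: "fps_nth (F - 1) 0 = 0"
    using assms by simp
  have "fps_rat_power F (of_nat m + of_nat l * s) = ((1 + fps_X) ^ m * fps_binomial s ^ l) oo (F - 1)"
    by (simp only: fps_rat_power_def fps_binomial_add_mult fps_binomial_power fps_binomial_of_nat)
  also have "\<dots> = ((1 + fps_X) oo (F - 1)) ^ m * (fps_binomial s oo (F - 1)) ^ l"
    by (simp only: fps_compose_mult_distrib[OF 0] fps_compose_power[OF 0])
  also have "(1 + fps_X) oo (F - 1) = F"
    using 0 by (simp add: fps_compose_add_distrib)
  finally show ?thesis
    by (simp only: fps_rat_power_def)
qed

lemma triangle_mod_5:
  assumes "\<not> 5 dvd 2 * int k + 1"
  shows "triangle k mod 5 \<in> {0, 1}"
proof -
  have "2 * triangle k = k * Suc k"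
    by (simp add: triangle_def)
  then have "(2 * triangle k) mod 5 = ((k mod 5) * (Suc k mod 5)) mod 5"
    by (simp only: mod_mult_eq)
  \<comment> \<open>The hypothesis rules out exactly the residue 2; the others make
    \<open>k * Suc k\<close> congruent to 0 or 2, to be halved modulo 5.\<close>
  moreover have "k mod 5 = 0 \<or> k mod 5 = 1 \<and> Suc k mod 5 = 2 \<or> k mod 5 = 3 \<and> Suc k mod 5 = 4
      \<or> Suc k mod 5 = 0"
    using assms by presburger
  ultimately have "(2 * triangle k) mod 5 = 0 \<or> (2 * triangle k) mod 5 = 2"
    by auto
  then show ?thesis
    by simp presburger
qed

lemma prime_5: "prime (5 :: nat)"
  by simp

lemma euler_prod_cubed_mod_5:
  assumes "i \<le> M" "2 * M \<le> n" "i mod 5 \<notin> {0, 1}"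
  shows "fps_nth (euler_prod n ^ 3) i / 5 \<in> zloc 5"
proof -
  have "(if triangle k = i then of_int (jacobi_coeff k) else 0) / 5 \<in> zloc 5" for k
  proof (cases "triangle k = i")
    case True
    then have "5 dvd jacobi_coeff k"
      using triangle_mod_5[of k] assms(3) unfolding jacobi_coeff_def by (intro dvd_mult) auto
    then obtain c where "jacobi_coeff k = 5 * c"
      by (rule dvdE)
    then show ?thesis
      using True zloc_of_int[OF prime_5] by simp
  qed (simp add: zloc_0[OF prime_5])
  then show ?thesis
    unfolding euler_prod_cubed_nth[OF assms(1,2)] sum_divide_distrib
    by (intro zloc_sum prime_5)
qed

lemma euler_prod_zloc:
  assumes "prime p"
  shows "euler_prod n \<in> zloc_fps p"
  unfolding euler_prod_def using assms
  by (intro zloc_fps_prod zloc_fps_diff zloc_fps_1 zloc_fps_X_power)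

text \<open>In each product of coefficients at \<open>u\<close> and \<open>4 * v\<close> with
  \<open>u + 4 * v = i\<close>, one factor is divisible by 5 by Jacobi's identity and the other is
  5-integral.\<close>

lemma euler_prod_4_cubed_mod_5:
  assumes "i \<le> M" "2 * M \<le> n" "i mod 5 \<in> {2, 3}"
  shows "fps_nth ((euler_prod n * (euler_prod n oo fps_X ^ 4)) ^ 3) i / 5 \<in> zloc 5"
proof -
  define E :: "rat fps" where "E = euler_prod n ^ 3"
  have E: "fps_nth E u \<in> zloc 5" for u
    unfolding E_def using prime_5 by (intro zloc_fpsD zloc_fps_power euler_prod_zloc)
  have E5: "fps_nth E u / 5 \<in> zloc 5" if "u \<le> i" "u mod 5 \<notin> {0, 1}" for u
    unfolding E_def using that assms by (intro euler_prod_cubed_mod_5[of _ M]) auto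
  have "(euler_prod n * (euler_prod n oo fps_X ^ 4)) ^ 3 = E * (E oo fps_X ^ 4)"
    by (simp add: E_def power_mult_distrib fps_compose_power)
  moreover have "fps_nth E u * fps_nth (E oo fps_X ^ 4) (i - u) / 5 \<in> zloc 5" if u: "u \<le> i" for u
  proof (cases "4 dvd i - u")
    case True
    then obtain v where v: "i - u = 4 * v"
      by (rule dvdE)
    then have nth: "fps_nth (E oo fps_X ^ 4) (i - u) = fps_nth E v"
      by (simp add: fps_nth_compose_X_power)
    have "u mod 5 \<notin> {0, 1} \<or> v mod 5 \<notin> {0, 1}"
    proof (rule ccontr)
      assume "\<not> ?thesis"
      then have "(u mod 5 + 4 * (v mod 5)) mod 5 \<in> {0, 1, 4}"
        by auto
      moreover have "i = u + 4 * v"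
        using u v by simp
      ultimately show False
        using assms(3) mod_add_eq[of u 5 "4 * v"] mod_mult_right_eq[of 4 v 5]
          mod_add_right_eq[of "u mod 5" "4 * (v mod 5)" 5] mod_add_right_eq[of "u mod 5" "4 * v" 5]
        by auto
    qed
    then show ?thesis
    proof
      assume "u mod 5 \<notin> {0, 1}"
      from zloc_mult[OF prime_5 E5[OF u this] E[of v]] show ?thesis
        by (simp add: nth)
    next
      assume "v mod 5 \<notin> {0, 1}"
      moreover have "v \<le> i"
        using v by simp
      ultimately show ?thesis
        using zloc_mult[OF prime_5 E[of u] E5[of v]] by (simp add: nth)
    qed
  qed (simp add: fps_nth_compose_X_power zloc_0[OF prime_5])
  ultimately show ?thesis
    by (auto simp: fps_mult_nth sum_divide_distrib intro!: zloc_sum[OF prime_5])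
qed

text \<open>Convergence makes the coefficient of the partial products eventually equal to the limit;
  by \<open>p_partial_prod_nth\<close> it is constant from index \<open>i\<close> on.\<close>

lemma p_coeff_eq:
  assumes "m > 0" "i \<le> n"
  shows "p_coeff m t i = fps_nth (\<Prod>j\<le>n. p_factor m t j) i"
proof -
  have "(\<lambda>n. \<Prod>j\<le>n. p_factor m t j) \<longlonglongrightarrow> p_series m t"
    using p_series_has_prod[OF assms(1)] by (rule has_prod_imp_tendsto)
  then have "\<forall>\<^sub>F k in sequentially. fps_nth (\<Prod>j\<le>k. p_factor m t j) i = p_coeff m t i"
    by (simp add: tendsto_fps_iff p_coeff_def)
  then obtain K where K: "\<And>k. k \<ge> K \<Longrightarrow> fps_nth (\<Prod>j\<le>k. p_factor m t j) i = p_coeff m t i"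
    by (auto simp: eventually_sequentially)
  show ?thesis
    using K[of "max K n"] p_partial_prod_nth[OF assms(1), of i n "max K n"]
      p_partial_prod_nth[OF assms(1), of i i n] p_partial_prod_nth[OF assms(1), of i i "max K n"] assms(2) by simp
qed

theorem theorem1p15:
  fixes k b n r :: nat
  assumes "k \<ge> 1" and "b > 0" and "gcd 5 b = 1" and "r \<in> {2, 3}"
  shows "5 dvd fst (quotient_of (p_coeff 4 (- (5 ^ k - 3 * of_nat b) / of_nat b) (5 * n + r)))"
proof -
  define N where "N = 5 * n + r"
  define s :: rat where "s = of_int (- (5 ^ (k - 1))) / of_int (int b)"
  define t :: rat where "t = of_nat 3 + of_nat 5 * s"
  define F :: "nat \<Rightarrow> rat fps" where "F j = (1 - fps_X ^ Suc j) * (1 - fps_X ^ (4 * Suc j))" for j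
  define G where "G = (\<Prod>j\<le>2 * N. fps_rat_power (F j) s)"
  \<comment> \<open>The bound \<open>2 * N\<close> is what the truncated Jacobi identity requires in
    order to be valid up to degree \<open>N\<close>; the range \<open>j <= 2 * N\<close> has
    \<open>Suc (2 * N)\<close> factors.\<close>
  define E :: "rat fps" where "E = euler_prod (Suc (2 * N))"
  define A where "A = (E * (E oo fps_X ^ 4)) ^ 3"
  have "(5::rat) ^ k = 5 * 5 ^ (k - 1)"
    using assms(1) by (cases k) simp_all
  then have t: "- (5 ^ k - 3 * of_nat b) / of_nat b = t"
    using assms(2) by (simp add: t_def s_def field_simps)
  have "\<not> 5 dvd b"
    using assms(3) by (metis dvd_refl gcd_greatest_iff nat_dvd_1_iff_1 numeral_eq_one_iff semiring_norm(86))
  then have s: "s \<in> zloc 5"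
    unfolding s_def by (intro zlocI) presburger
  have F: "F j \<in> zloc_fps 5" for j
    unfolding F_def by (intro prime_5 zloc_fps_mult zloc_fps_diff zloc_fps_1 zloc_fps_X_power)
  have G: "G \<in> zloc_fps 5"
    unfolding G_def by (intro prime_5 zloc_fps_prod zloc_fps_rat_power F s)
  have "(\<Prod>j\<le>2 * N. F j) = E * (\<Prod>j\<le>2 * N. 1 - fps_X ^ (4 * Suc j))"
    by (simp only: F_def E_def euler_prod_def prod.distrib lessThan_Suc_atMost)
  also have "(\<Prod>j\<le>2 * N. 1 - fps_X ^ (4 * Suc j)) = (E oo fps_X ^ 4)"
    by (simp add: E_def euler_prod_def lessThan_Suc_atMost fps_compose_prod_distrib
        fps_compose_sub_distrib fps_X_power_compose power_mult del: power_Suc mult_Suc_right)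
  finally have A: "A = (\<Prod>j\<le>2 * N. F j) ^ 3"
    by (simp add: A_def)
  have "(\<Prod>j\<le>2 * N. p_factor 4 t j) = (\<Prod>j\<le>2 * N. F j ^ 3 * fps_rat_power (F j) s ^ 5)"
    unfolding p_factor_def F_def[symmetric] t_def
    by (intro prod.cong refl fps_rat_power_split) (simp add: F_def)
  also have "\<dots> = A * G ^ 5"
    by (simp add: A G_def prod.distrib prod_power_distrib)
  finally have "p_coeff 4 t N = fps_nth (A * G ^ 5) N"
    using p_coeff_eq[of 4 N "2 * N" t] by simp
  then have "p_coeff 4 t N / 5 = (\<Sum>i=0..N. fps_nth A i * fps_nth (G ^ 5) (N - i) / 5)"
    by (simp add: fps_mult_nth sum_divide_distrib)
  also have "\<dots> \<in> zloc 5"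
  proof (intro zloc_sum prime_5)
    fix i assume "i \<in> {0..N}"
    then have i: "i \<le> N"
      by simp
    show "fps_nth A i * fps_nth (G ^ 5) (N - i) / 5 \<in> zloc 5"
    \<comment> \<open>If 5 divides \<open>N - i\<close>, then \<open>i\<close> is 2 or 3 modulo 5
      and the factor from \<open>A\<close> supplies the 5; otherwise the factor from
      \<open>G ^ 5\<close> does.\<close>
    proof (cases "5 dvd N - i")
      case True
      then have "i mod 5 = N mod 5"
        using mod_eq_dvd_iff_nat[OF i, of 5] by simp
      also have "\<dots> \<in> {2, 3}"
        using assms(4) by (auto simp: N_def)
      finally have "fps_nth A i / 5 \<in> zloc 5"
        unfolding A_def E_def using i by (intro euler_prod_4_cubed_mod_5[of _ N]) simp_all
      moreover have "fps_nth (G ^ 5) (N - i) \<in> zloc 5"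
        by (intro prime_5 zloc_fpsD zloc_fps_power G)
      ultimately show ?thesis
        using zloc_mult[OF prime_5] by fastforce
    next
      case False
      have "fps_nth A i \<in> zloc 5"
        unfolding A using F by (intro prime_5 zloc_fpsD zloc_fps_power zloc_fps_prod)
      from zloc_mult[OF prime_5 this zloc_fps_power_prime_nth[OF prime_5 G False]] show ?thesis
        by simp
    qed
  qed
  finally have "int 5 dvd fst (quotient_of (p_coeff 4 t N))"
    by (intro dvd_numerator_if_zloc prime_5) simp
  then show ?thesis
    unfolding t N_def by simp
qed

end
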